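(* Let $x=(x_1,x_2,\dots,x_n)$ be a binary sequence of length $n>19$ with $x_1=1$ whose first $19$ elements have run length encoding $(3,3,6,3,2,2)$; that is, $x_1=x_2=x_3=1$, $x_4=x_5=x_6=-1$, $x_7=\dots=x_{12}=1$, $x_{13}=x_{14}=x_{15}=-1$, $x_{16}=x_{17}=1$, $x_{18}=x_{19}=-1$. Put $p=3$, $t=9$, and $z_j=x_{p(j-1)+1}$, so that $z=(1,-1,1,1,-1,1,-1,\dots)$. Then $x_i=1$ for $1\le i\le p$, $x_{p+1}=-1$, and $x$ satisfies equation $(k)$ for all $1\le k\le t=9$, but $z$ does not satisfy equation $(k)$ for $k=3$, although $3\le \frac{t}{p}$. Consequently the following assertion is false: "if a binary sequence $x$ satisfies equation $(k)$ for $1\le k\le t$, and $x_i=1$ for $1\le i\le p$, $x_{p+1}=-1$ with $p>1$, then the sequence $z_j=x_{p(j-1)+1}$ satisfies equation $(k)$ for all $1\le k\le \frac{t}{p}$."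
   Context: A binary sequence of length $n$ is $x=(x_1,\dots,x_n)$ with each $x_i\in\{-1,1\}$. For $1\le k<\frac{n-1}{2}$, the sequence $x$ is said to satisfy equation $(k)$ if $$\frac{1+(-1)^{k+1}}{2}=\sum_{i=1}^{k}(-1)^{i+1}x_i x_{2k+2-i}.$$ Whether equation $(k)$ holds depends only on the first $2k+1$ elements of the sequence, so for the sequence $z$ the equation $(k)$ is to be read as this identity with $z_1,\dots,z_{2k+1}$ in place of $x_1,\dots,x_{2k+1}$. The run length encoding of a finite sequence is the list of the lengths of its successive maximal blocks of equal consecutive elements. *)

theory Defs
  imports Complex_Main
begin

text \<open>Finite sequences are lists; \<open>entry x i\<close> is the \<open>i\<close>-th element counted from \<open>1\<close>.\<close>

definition entry :: "'a list \<Rightarrow> nat \<Rightarrow> 'a" where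
  "entry x i = x ! (i - 1)"

definition binary_seq :: "nat \<Rightarrow> int list \<Rightarrow> bool" where
  "binary_seq n x \<longleftrightarrow> length x = n \<and> set x \<subseteq> {-1, 1}"

text \<open>The bare identity behind equation \<open>(k)\<close>. It refers only to \<open>y 1, \<dots>, y (2 * k + 1)\<close>.\<close>

definition eq_identity :: "(nat \<Rightarrow> int) \<Rightarrow> nat \<Rightarrow> bool" where
  "eq_identity y k \<longleftrightarrow>
     (1 + (-1) ^ (k + 1)) / 2 = real_of_int (\<Sum>i = 1..k. (-1) ^ (i + 1) * y i * y (2 * k + 2 - i))"

text \<open>For a sequence of length \<open>n\<close>, equation \<open>(k)\<close> is only considered for
  \<open>1 \<le> k < (n - 1) / 2\<close>, so satisfying it includes this range condition.\<close>

definition satisfies_eq :: "int list \<Rightarrow> nat \<Rightarrow> bool" where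
  "satisfies_eq x k \<longleftrightarrow>
     1 \<le> k \<and> real k < (real (length x) - 1) / 2 \<and> eq_identity (entry x) k"

text \<open>The sequence \<open>z j = x (p * (j - 1) + 1)\<close>, to be read for \<open>j \<ge> 1\<close> with
  \<open>p * (j - 1) + 1 \<le> length x\<close>. If \<open>2 * t + 1 < length x\<close> and \<open>k \<le> t / p\<close>, then
  \<open>z 1, \<dots>, z (2 * k + 1)\<close> all lie in this range.\<close>

definition decimate :: "nat \<Rightarrow> 'a list \<Rightarrow> nat \<Rightarrow> 'a" where
  "decimate p x j = entry x (p * (j - 1) + 1)"

function run_lengths :: "'a list \<Rightarrow> nat list" where
  "run_lengths [] = []"
| "run_lengths (a # xs) =
     Suc (length (takeWhile (\<lambda>b. b = a) xs)) # run_lengths (dropWhile (\<lambda>b. b = a) xs)"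
  by pat_completeness auto
termination
  by (relation "measure length") (auto simp: le_imp_less_Suc length_dropWhile_le)

end

theory Submission
  imports Defs
begin

text \<open>Over \<open>{-1, 1}\<close> a sequence is determined by its first element and its run lengths, so
  the hypotheses fix the first 19 elements. These are all that the equations \<open>(1)\<close> to \<open>(9)\<close>
  for \<open>x\<close> and equation \<open>(3)\<close> for \<open>z\<close> refer to, so everything reduces to evaluating finite sums.\<close>

fun alternating_runs :: "int \<Rightarrow> nat list \<Rightarrow> int list" where
  "alternating_runs a [] = []"
| "alternating_runs a (m # ms) = replicate m a @ alternating_runs (- a) ms"

text \<open>With only two values available, crossing a block boundary must flip the sign, so the
  encoding forgets nothing but the first element. The condition on \<open>hd\<close> is guarded
  because the induction also reaches the empty remainder after the last block.\<close>

lemma alternating_runs_run_lengths: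
  assumes "set xs \<subseteq> {-1, 1}" and "xs \<noteq> [] \<Longrightarrow> hd xs = a"
  shows "alternating_runs a (run_lengths xs) = xs"
  using assms
proof (induction xs arbitrary: a rule: run_lengths.induct)
  case 1
  then show ?case by simp
next
  case (2 b xs)
  let ?ys = "takeWhile (\<lambda>c. c = b) xs" and ?zs = "dropWhile (\<lambda>c. c = b) xs"
  from 2 have ab: "a = b" by simp
  have "replicate (length ?ys) b = ?ys"
    by (rule replicate_eqI[symmetric]) (auto dest: set_takeWhileD)
  moreover have "alternating_runs (- b) (run_lengths ?zs) = ?zs"
  proof (rule "2.IH")
    show "set ?zs \<subseteq> {-1, 1}"
      using "2.prems"(1) set_dropWhileD[of _ "\<lambda>c. c = b" xs] by auto
    \<comment> \<open>What stops \<open>dropWhile\<close> differs from \<open>b\<close>, and in {-1,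
      1} this leaves only \<open>- b\<close>.\<close>
    show "hd ?zs = - b" if "?zs \<noteq> []"
    proof -
      have "hd ?zs \<in> {-1, 1}"
        using \<open>set ?zs \<subseteq> {-1, 1}\<close> that hd_in_set by blast
      with hd_dropWhile[OF that] "2.prems"(1) show ?thesis by auto
    qed
  qed
  ultimately show ?case
    by (simp add: ab)
qed

lemma entry_take: "1 \<le> i \<Longrightarrow> i \<le> m \<Longrightarrow> entry (take m x) i = entry x i"
  by (simp add: entry_def)

abbreviation (input) prefix19 :: "int list" where
  "prefix19 \<equiv> [1, 1, 1, -1, -1, -1, 1, 1, 1, 1, 1, 1, -1, -1, -1, 1, 1, -1, -1]"

lemma take19_eq:
  assumes "binary_seq n x" "n > 19" "entry x 1 = 1"
    and "run_lengths (take 19 x) = [3, 3, 6, 3, 2, 2]"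
  shows "take 19 x = prefix19"
proof -
  have "x \<noteq> []" using assms(1,2) by (auto simp: binary_seq_def)
  then have "alternating_runs 1 (run_lengths (take 19 x)) = take 19 x"
    using assms(1,3) set_take_subset[of 19 x]
    by (intro alternating_runs_run_lengths) (auto simp: binary_seq_def entry_def hd_conv_nth)
  then show ?thesis
    \<comment> \<open>Numerals become successors so that each \<open>replicate\<close> unrolls to an
      explicit list.\<close>
    unfolding assms(4) by (simp add: numeral_eq_Suc)
qed

text \<open>As a conditional rewrite rule this turns every entry with a literal index into a lookup
  in a concrete list, which \<open>simp\<close> evaluates.\<close>

lemma entry_prefix19:
  assumes "take 19 x = prefix19" "1 \<le> i" "i \<le> 19"
  shows "entry x i = prefix19 ! (i - 1)"
  using entry_take[OF assms(2,3), of x] unfolding assms(1) by (simp add: entry_def)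

lemma satisfies_eq_prefix19:
  assumes "take 19 x = prefix19" "length x > 19" "1 \<le> k" "k \<le> 9"
  shows "satisfies_eq x k"
proof -
  have "k \<in> {1, 2, 3, 4, 5, 6, 7, 8, 9}" using assms(3,4) by auto
  then have "eq_identity (entry x) k"
    unfolding eq_identity_def
    by (elim insertE emptyE)
      (simp_all add: entry_prefix19[OF assms(1)] sum.atLeast_Suc_atMost)
  with assms show ?thesis by (simp add: satisfies_eq_def)
qed

lemma decimate_prefix19:
  assumes "take 19 x = prefix19"
  shows "map (decimate 3 x) [1..<8] = [1, -1, 1, 1, -1, 1, -1]"
  by (simp add: upt_conv_Cons decimate_def entry_prefix19[OF assms])

text \<open>The left side is 1, whereas z1 z7 - z2 z6 + z3 z5 = -1 + 1 - 1 = -1. The last value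
  needed, z7, is entry 3 * 6 + 1 = 19 of x, still inside the prefix.\<close>

lemma not_eq_identity_decimate_prefix19:
  assumes "take 19 x = prefix19"
  shows "\<not> eq_identity (decimate 3 x) 3"
  by (simp add: eq_identity_def decimate_def entry_prefix19[OF assms] sum.atLeast_Suc_atMost)

theorem mainTheorem1:
  shows "(\<forall>(n::nat) (x::int list).
      binary_seq n x \<and> n > 19 \<and> entry x 1 = 1 \<and> run_lengths (take 19 x) = [3, 3, 6, 3, 2, 2] \<longrightarrow>
      (let p = (3::nat); t = (9::nat); z = decimate p x in
         take 19 x = [1, 1, 1, -1, -1, -1, 1, 1, 1, 1, 1, 1, -1, -1, -1, 1, 1, -1, -1] \<and>
         map z [1..<8] = [1, -1, 1, 1, -1, 1, -1] \<and>
         (\<forall>i. 1 \<le> i \<and> i \<le> p \<longrightarrow> entry x i = 1) \<and>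
         entry x (p + 1) = -1 \<and>
         (\<forall>k. 1 \<le> k \<and> k \<le> t \<longrightarrow> satisfies_eq x k) \<and>
         \<not> eq_identity z 3 \<and>
         3 \<le> real t / real p))
    \<and> \<not> (\<forall>(n::nat) (x::int list) (t::nat) (p::nat).
      binary_seq n x \<and>
      (\<forall>k. 1 \<le> k \<and> k \<le> t \<longrightarrow> satisfies_eq x k) \<and>
      p > 1 \<and> p + 1 \<le> n \<and>
      (\<forall>i. 1 \<le> i \<and> i \<le> p \<longrightarrow> entry x i = 1) \<and> entry x (p + 1) = -1 \<longrightarrow>
      (\<forall>k. 1 \<le> k \<and> real k \<le> real t / real p \<longrightarrow> eq_identity (decimate p x) k))"
proof (intro conjI)
  \<comment> \<open>Both facts are stated for arbitrary \<open>x\<close>, since they serve the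
    universal claim and the concrete counterexample alike.\<close>
  have first: "entry x i = 1" if "take 19 x = prefix19" "1 \<le> i" "i \<le> 3" for x i
  proof -
    have "i \<in> {1, 2, 3}" using that(2,3) by auto
    then show ?thesis using entry_prefix19[OF that(1)] by auto
  qed
  have fourth: "entry x (3 + 1) = -1" if "take 19 x = prefix19" for x
    by (simp add: entry_prefix19[OF that])
  show "\<forall>n x. binary_seq n x \<and> n > 19 \<and> entry x 1 = 1 \<and>
      run_lengths (take 19 x) = [3, 3, 6, 3, 2, 2] \<longrightarrow>
      (let p = (3::nat); t = (9::nat); z = decimate p x in
         take 19 x = prefix19 \<and>
         map z [1..<8] = [1, -1, 1, 1, -1, 1, -1] \<and>
         (\<forall>i. 1 \<le> i \<and> i \<le> p \<longrightarrow> entry x i = 1) \<and>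
         entry x (p + 1) = -1 \<and>
         (\<forall>k. 1 \<le> k \<and> k \<le> t \<longrightarrow> satisfies_eq x k) \<and>
         \<not> eq_identity z 3 \<and>
         3 \<le> real t / real p)"
    unfolding Let_def
  proof (intro allI impI, elim conjE)
    fix n :: nat and x :: "int list"
    assume x: "binary_seq n x" "n > 19" "entry x 1 = 1"
      "run_lengths (take 19 x) = [3, 3, 6, 3, 2, 2]"
    then have T: "take 19 x = prefix19" by (rule take19_eq)
    have len: "length x > 19" using x(1,2) by (simp add: binary_seq_def)
    show "take 19 x = prefix19 \<and>
         map (decimate 3 x) [1..<8] = [1, -1, 1, 1, -1, 1, -1] \<and>
         (\<forall>i. 1 \<le> i \<and> i \<le> 3 \<longrightarrow> entry x i = 1) \<and>
         entry x (3 + 1) = -1 \<and>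
         (\<forall>k. 1 \<le> k \<and> k \<le> 9 \<longrightarrow> satisfies_eq x k) \<and>
         \<not> eq_identity (decimate 3 x) 3 \<and>
         3 \<le> real 9 / real 3"
      using T decimate_prefix19[OF T] first[OF T] fourth[OF T] satisfies_eq_prefix19[OF T len]
        not_eq_identity_decimate_prefix19[OF T]
      by (intro conjI allI impI) (assumption | simp)+
  qed
  \<comment> \<open>A shortest admissible extension of the prefix. The value of the 20th element is
    arbitrary, as no equation (k) with k \<le> 9 refers to it.\<close>
  define x where "x = prefix19 @ [1]"
  have T: "take 19 x = prefix19" and len: "length x = 20" and bin: "binary_seq 20 x"
    by (simp_all add: x_def binary_seq_def)
  show "\<not> (\<forall>(n::nat) (x::int list) (t::nat) (p::nat).
      binary_seq n x \<and>
      (\<forall>k. 1 \<le> k \<and> k \<le> t \<longrightarrow> satisfies_eq x k) \<and>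
      p > 1 \<and> p + 1 \<le> n \<and>
      (\<forall>i. 1 \<le> i \<and> i \<le> p \<longrightarrow> entry x i = 1) \<and> entry x (p + 1) = -1 \<longrightarrow>
      (\<forall>k. 1 \<le> k \<and> real k \<le> real t / real p \<longrightarrow> eq_identity (decimate p x) k))"
  proof
    assume conj: "\<forall>(n::nat) (x::int list) (t::nat) (p::nat).
      binary_seq n x \<and>
      (\<forall>k. 1 \<le> k \<and> k \<le> t \<longrightarrow> satisfies_eq x k) \<and>
      p > 1 \<and> p + 1 \<le> n \<and>
      (\<forall>i. 1 \<le> i \<and> i \<le> p \<longrightarrow> entry x i = 1) \<and> entry x (p + 1) = -1 \<longrightarrow>
      (\<forall>k. 1 \<le> k \<and> real k \<le> real t / real p \<longrightarrow> eq_identity (decimate p x) k)"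
    \<comment> \<open>The refuted assertion is instantiated at n = 20, t = 9, p = 3; since 9 / 3 =
      3, its conclusion covers the failing case k = 3.\<close>
    have "\<forall>k. 1 \<le> k \<and> real k \<le> real 9 / real 3 \<longrightarrow> eq_identity (decimate 3 x) k"
      using bin satisfies_eq_prefix19[OF T] len first[OF T] fourth[OF T]
      by (intro conj[THEN spec, THEN spec, THEN spec, THEN spec, THEN mp, of 20 x 9 3]) auto
    then have "eq_identity (decimate 3 x) 3" by simp
    with not_eq_identity_decimate_prefix19[OF T] show False ..
  qed
qed

end
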